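(* Let $a,b\ge 1$. No triangulation of the product of two simplices $\Delta^a\times\Delta^b$, even one whose vertex set includes points that are not vertices of $\Delta^a\times\Delta^b$, has fewer simplices than a vertex triangulation of $\Delta^a\times\Delta^b$ (for example the standard triangulation, which has $\binom{a+b}{a}$ simplices). That is, a minimal triangulation of $\Delta^a\times\Delta^b$ has $\binom{a+b}{a}$ simplices.
   Context: $\Delta^d$ is the $d$-dimensional simplex (convex hull of the standard unit vectors in $\mathbb{R}^{d+1}$). A triangulation of a polytope $P$ is a decomposition of $P$ into full-dimensional simplices meeting face-to-face; its vertices may be arbitrary points of $P$. A vertex triangulation is a triangulation whose vertices are all vertices of $P$; every vertex triangulation of $\Delta^a\times\Delta^b$ has exactly $\binom{a+b}{a}$ simplices. *)

theory Defs
  imports "HOL-Analysis.Analysis"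
begin

definition std_simplex :: "(real^'n) set" where
  "std_simplex = convex hull (range (\<lambda>i. axis i 1))"

definition vertices :: "'a::real_vector set \<Rightarrow> 'a set" where
  "vertices P = {v. v extreme_point_of P}"

text \<open>
  The library predicate \<^const>\<open>triangulation\<close> says that the cells form a finite family of
  simplices (of arbitrary dimensions) that meet face-to-face; it allows the empty set as a common
  face and does not mention the set being decomposed.
\<close>

definition triangulates :: "'a::euclidean_space set set \<Rightarrow> 'a set \<Rightarrow> bool" where
  "triangulates \<T> P \<longleftrightarrow>
     triangulation \<T> \<and> (\<forall>T\<in>\<T>. (aff_dim P) simplex T) \<and> \<Union>\<T> = P"

definition vertex_triangulates :: "'a::euclidean_space set set \<Rightarrow> 'a set \<Rightarrow> bool" where
  "vertex_triangulates \<T> P \<longleftrightarrow>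
     triangulates \<T> P \<and> (\<forall>T\<in>\<T>. vertices T \<subseteq> vertices P)"

definition minimally_triangulates :: "'a::euclidean_space set set \<Rightarrow> 'a set \<Rightarrow> bool" where
  "minimally_triangulates \<T> P \<longleftrightarrow>
     triangulates \<T> P \<and> (\<forall>\<U>. triangulates \<U> P \<longrightarrow> card \<T> \<le> card \<U>)"

end

(* Place the product P in the (a+b+2)-dimensional coordinate space indexed by both factors; its
   vertices become the sums e_i + f_j. The normalized volume of a cell is the absolute value of a
   determinant whose rows are the vertices of the cell and one further unit vector. The determinant
   is affine in each vertex, so it is bounded by its values at vertices of P, and these are 0, 1 or
   -1 because incidence matrices of bipartite graphs are totally unimodular. Hence all cells of a
   vertex triangulation have the same volume and no cell of any triangulation has a larger one,
   so comparing total volumes compares the numbers of cells.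

   The staircase triangulation has one cell for each lattice path from (0,0) to (a,b). It is a
   triangulation because every point of P, read as a pair of marginals, has exactly one coupling
   supported on a staircase, whose cumulative sums are the minima of the cumulative marginals. *)

theory Submission
  imports Defs
begin

subsection \<open>Lattice paths and staircase couplings\<close>

text \<open>Chains of the componentwise order: points with equal first coordinate are comparable
  anyway, so only pairs with distinct first coordinates are constrained.\<close>

definition staircase :: "(nat \<times> nat) set \<Rightarrow> bool" where
  "staircase C \<longleftrightarrow> (\<forall>p\<in>C. \<forall>q\<in>C. fst p < fst q \<longrightarrow> snd p \<le> snd q)"

lemma staircaseD: "staircase C \<Longrightarrow> (i, j) \<in> C \<Longrightarrow> (i', j') \<in> C \<Longrightarrow> i < i' \<Longrightarrow> j \<le> j'"
  unfolding staircase_def by (metis fst_conv snd_conv)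

lemma staircase_subset: "staircase D \<Longrightarrow> C \<subseteq> D \<Longrightarrow> staircase C"
  unfolding staircase_def by blast

text \<open>A path is recorded as the set of points it visits, and the recursion strips off its end
  point. These sets turn out to be the maximal staircases in the grid.\<close>

fun lattice_paths :: "nat \<Rightarrow> nat \<Rightarrow> (nat \<times> nat) set set" where
  "lattice_paths 0 0 = {{(0, 0)}}"
| "lattice_paths (Suc a) 0 = insert (Suc a, 0) ` lattice_paths a 0"
| "lattice_paths 0 (Suc b) = insert (0, Suc b) ` lattice_paths 0 b"
| "lattice_paths (Suc a) (Suc b) =
     insert (Suc a, Suc b) ` (lattice_paths a (Suc b) \<union> lattice_paths (Suc a) b)"

lemma lattice_path_subset_grid: "C \<in> lattice_paths a b \<Longrightarrow> C \<subseteq> {..a} \<times> {..b}"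
proof (induction a b arbitrary: C rule: lattice_paths.induct)
  case (4 a b)
  then obtain D where D: "C = insert (Suc a, Suc b) D"
    "D \<in> lattice_paths a (Suc b) \<or> D \<in> lattice_paths (Suc a) b" by auto
  then have "D \<subseteq> {..a} \<times> {..Suc b} \<or> D \<subseteq> {..Suc a} \<times> {..b}" using 4 by blast
  then have "D \<subseteq> {..Suc a} \<times> {..Suc b}" by (auto simp: subset_iff le_Suc_eq)
  then show ?case using D by simp
next
  case (2 a)
  then obtain D where D: "C = insert (Suc a, 0) D" "D \<in> lattice_paths a 0" by auto
  then have "D \<subseteq> {..a} \<times> {..0}" using 2 by blast
  then show ?case using D by (auto simp: subset_iff le_Suc_eq)
next
  case (3 b)
  then obtain D where D: "C = insert (0, Suc b) D" "D \<in> lattice_paths 0 b" by auto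
  then have "D \<subseteq> {..0} \<times> {..b}" using 3 by blast
  then show ?case using D by (auto simp: subset_iff le_Suc_eq)
qed simp

lemma finite_lattice_path: "C \<in> lattice_paths a b \<Longrightarrow> finite C"
  using finite_subset[OF lattice_path_subset_grid] by simp

lemma lattice_path_end: "C \<in> lattice_paths a b \<Longrightarrow> (a, b) \<in> C"
  by (induction a b arbitrary: C rule: lattice_paths.induct) auto

text \<open>The corner is the greatest element of the grid, hence comparable with every
  point.\<close>

lemma staircase_insert_corner:
  assumes "staircase C" and "insert (a, b) C \<subseteq> {..a} \<times> {..b}"
  shows "staircase (insert (a, b) C)"
  unfolding staircase_def
proof (intro ballI impI)
  fix p q
  assume "p \<in> insert (a, b) C" "q \<in> insert (a, b) C" "fst p < fst q"
  moreover from this have "fst q \<le> a" "snd p \<le> b" using assms(2) by auto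
  ultimately show "snd p \<le> snd q" using assms(1) by (auto simp: staircase_def)
qed

lemma staircase_lattice_path: "C \<in> lattice_paths a b \<Longrightarrow> staircase C"
proof (induction a b arbitrary: C rule: lattice_paths.induct)
  case 1
  then show ?case by (simp add: staircase_def)
next
  case (2 a)
  then obtain D where "C = insert (Suc a, 0) D" "staircase D" by auto
  then show ?case using lattice_path_subset_grid[OF 2(2)] staircase_insert_corner by blast
next
  case (3 b)
  then obtain D where "C = insert (0, Suc b) D" "staircase D" by auto
  then show ?case using lattice_path_subset_grid[OF 3(2)] staircase_insert_corner by blast
next
  case (4 a b)
  then obtain D where "C = insert (Suc a, Suc b) D" "staircase D" by auto
  then show ?case using lattice_path_subset_grid[OF 4(3)] staircase_insert_corner by blast
qed

lemma corner_notin_lattice_path: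
  "C \<in> lattice_paths a b \<Longrightarrow> a < i \<or> b < j \<Longrightarrow> (i, j) \<notin> C"
  using lattice_path_subset_grid[of C a b] by auto

lemma card_lattice_path: "C \<in> lattice_paths a b \<Longrightarrow> card C = a + b + 1"
proof (induction a b arbitrary: C rule: lattice_paths.induct)
  case 1
  then show ?case by simp
next
  case (2 a)
  then show ?case by (auto simp: corner_notin_lattice_path finite_lattice_path)
next
  case (3 b)
  then show ?case by (auto simp: corner_notin_lattice_path finite_lattice_path)
next
  case (4 a b)
  then show ?case by (auto simp: corner_notin_lattice_path finite_lattice_path)
qed

lemma finite_lattice_paths: "finite (lattice_paths a b)"
  by (induction a b rule: lattice_paths.induct) auto

lemma inj_on_insert_new: "(\<And>C. C \<in> F \<Longrightarrow> x \<notin> C) \<Longrightarrow> inj_on (insert x) F"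
  by (rule inj_onI) (simp add: insert_ident)

text \<open>Pascal's rule for the last step of a path. The two families are disjoint because members
  of the second contain \<open>(Suc a, b)\<close>, which lies outside the grid of the first.\<close>

lemma card_lattice_paths: "card (lattice_paths a b) = (a + b) choose a"
proof (induction a b rule: lattice_paths.induct)
  case 1
  then show ?case by simp
next
  case (2 a)
  have "inj_on (insert (Suc a, 0)) (lattice_paths a 0)"
    by (intro inj_on_insert_new) (simp add: corner_notin_lattice_path)
  with 2 show ?case by (simp add: card_image)
next
  case (3 b)
  have "inj_on (insert (0, Suc b)) (lattice_paths 0 b)"
    by (intro inj_on_insert_new) (simp add: corner_notin_lattice_path)
  with 3 show ?case by (simp add: card_image)
next
  case (4 a b)
  have "inj_on (insert (Suc a, Suc b)) (lattice_paths a (Suc b) \<union> lattice_paths (Suc a) b)"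
    by (intro inj_on_insert_new) (auto simp: corner_notin_lattice_path)
  moreover have "lattice_paths a (Suc b) \<inter> lattice_paths (Suc a) b = {}"
    using lattice_path_end[of _ "Suc a" b] corner_notin_lattice_path[of _ a "Suc b" "Suc a" b]
    by auto
  ultimately show ?case
    using 4 by (simp add: card_image card_Un_disjoint finite_lattice_paths)
qed

text \<open>Induction by removing the corner: what is left cannot meet both outer sides of the grid,
  since two such points would be incomparable, so it fits into one of the two smaller grids.\<close>

lemma staircase_subset_lattice_path:
  assumes "staircase C" and "C \<subseteq> {..a} \<times> {..b}"
  shows "\<exists>D\<in>lattice_paths a b. C \<subseteq> D"
  using assms
proof (induction a b arbitrary: C rule: lattice_paths.induct)
  case 1
  then show ?case by auto
next
  case (2 a)
  have "C - {(Suc a, 0)} \<subseteq> {..a} \<times> {..0}"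
    using 2(3) by (auto simp: le_Suc_eq)
  with 2 obtain D where "D \<in> lattice_paths a 0" "C - {(Suc a, 0)} \<subseteq> D"
    by (meson staircase_subset Diff_subset)
  then show ?case by auto
next
  case (3 b)
  have "C - {(0, Suc b)} \<subseteq> {..0} \<times> {..b}"
    using 3(3) by (auto simp: le_Suc_eq)
  with 3 obtain D where "D \<in> lattice_paths 0 b" "C - {(0, Suc b)} \<subseteq> D"
    by (meson staircase_subset Diff_subset)
  then show ?case by auto
next
  case (4 a b)
  let ?C = "C - {(Suc a, Suc b)}"
  have sc: "staircase ?C" using 4(3) by (meson staircase_subset Diff_subset)
  have "?C \<subseteq> {..a} \<times> {..Suc b} \<or> ?C \<subseteq> {..Suc a} \<times> {..b}"
  proof (rule ccontr)
    assume "\<not> ?thesis"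
    then obtain i j i' j' where *: "(i, j) \<in> ?C" "\<not> (i \<le> a \<and> j \<le> Suc b)"
      "(i', j') \<in> ?C" "\<not> (i' \<le> Suc a \<and> j' \<le> b)"
      by (auto simp: subset_iff)
    then have "i \<le> Suc a" "j \<le> Suc b" "i' \<le> Suc a" "j' \<le> Suc b"
      using 4(4) by auto
    with * have "i = Suc a" "j' = Suc b" "j \<le> b" "i' \<le> a"
      by (auto simp: le_Suc_eq)
    then show False
      using staircaseD[OF sc *(3,1)] by simp
  qed
  then obtain D where "D \<in> lattice_paths a (Suc b) \<union> lattice_paths (Suc a) b" "?C \<subseteq> D"
    using 4(1,2)[OF sc] by auto
  then show ?case by auto
qed

text \<open>The staircase condition forces one of the two off-diagonal blocks to carry no mass, so the
  cumulative sums of such an array are the minima of those of its marginals.\<close>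

lemma staircase_cumulative_sum:
  fixes f :: "nat \<times> nat \<Rightarrow> real"
  assumes nn: "\<And>p. 0 \<le> f p" and st: "staircase {p. f p \<noteq> 0}"
    and p: "p \<le> Suc a" and q: "q \<le> Suc b"
  shows "(\<Sum>i<p. \<Sum>j<q. f (i, j)) =
    min (\<Sum>i<p. \<Sum>j\<le>b. f (i, j)) (\<Sum>j<q. \<Sum>i\<le>a. f (i, j))" (is "?G = min ?X ?Y")
proof -
  have G': "?G = (\<Sum>j<q. \<Sum>i<p. f (i, j))" by (rule sum.swap)
  have X: "?G \<le> ?X" using q by (intro sum_mono sum_mono2) (auto simp: nn)
  have Y: "?G \<le> ?Y" unfolding G' using p by (intro sum_mono sum_mono2) (auto simp: nn)
  show ?thesis
  proof (cases "\<forall>i j. i < p \<longrightarrow> q \<le> j \<longrightarrow> f (i, j) = 0")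
    case True
    then have "?G = ?X"
      using q by (intro sum.cong sum.mono_neutral_left) auto
    then show ?thesis using X Y by simp
  next
    case False
    then obtain i j where ij: "i < p" "q \<le> j" "f (i, j) \<noteq> 0" by blast
    have "f (i', j') = 0" if "p \<le> i'" "j' < q" for i' j'
      using staircaseD[OF st, of i j i' j'] ij that by auto
    then have "?G = ?Y"
      unfolding G' using p by (intro sum.cong sum.mono_neutral_left) auto
    then show ?thesis using X Y by simp
  qed
qed

text \<open>The marginals determine all cumulative sums, and differencing once in each index
  recovers the entries.\<close>

lemma staircase_coupling_unique:
  fixes f g :: "nat \<times> nat \<Rightarrow> real"
  assumes "\<And>p. 0 \<le> f p" and "staircase {p. f p \<noteq> 0}"
    and "\<And>p. 0 \<le> g p" and "staircase {p. g p \<noteq> 0}"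
    and row: "\<And>i. i \<le> a \<Longrightarrow> (\<Sum>j\<le>b. f (i, j)) = (\<Sum>j\<le>b. g (i, j))"
    and col: "\<And>j. j \<le> b \<Longrightarrow> (\<Sum>i\<le>a. f (i, j)) = (\<Sum>i\<le>a. g (i, j))"
    and i: "i \<le> a" and j: "j \<le> b"
  shows "f (i, j) = g (i, j)"
proof -
  have G: "(\<Sum>i<p. \<Sum>j<q. f (i, j)) = (\<Sum>i<p. \<Sum>j<q. g (i, j))"
    if "p \<le> Suc a" "q \<le> Suc b" for p q
  proof -
    have "(\<Sum>i<p. \<Sum>j\<le>b. f (i, j)) = (\<Sum>i<p. \<Sum>j\<le>b. g (i, j))"
      using that by (intro sum.cong row) auto
    moreover have "(\<Sum>j<q. \<Sum>i\<le>a. f (i, j)) = (\<Sum>j<q. \<Sum>i\<le>a. g (i, j))"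
      using that by (intro sum.cong col) auto
    ultimately show ?thesis
      using that assms by (simp add: staircase_cumulative_sum[where a=a and b=b])
  qed
  have "(\<Sum>j<q. f (i, j)) = (\<Sum>j<q. g (i, j))" if "q \<le> Suc b" for q
    using G[of i q] G[of "Suc i" q] i that by simp
  from this[of j] this[of "Suc j"] show ?thesis using j by simp
qed

text \<open>The coupling built by the northwest corner rule: mass \<open>(i, j)\<close> is the length of the overlap
  of the \<open>i\<close>-th and \<open>j\<close>-th intervals, i.e. the mixed second difference of the minimum of
  the cumulative sums.\<close>

lemma staircase_coupling_exists:
  fixes x y :: "nat \<Rightarrow> real"
  assumes x: "\<And>i. 0 \<le> x i" and y: "\<And>j. 0 \<le> y j" and eq: "(\<Sum>i\<le>a. x i) = (\<Sum>j\<le>b. y j)"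
  obtains f where "\<And>p. 0 \<le> f p" and "staircase {p. f p \<noteq> 0}"
    and "\<And>i. i \<le> a \<Longrightarrow> (\<Sum>j\<le>b. f (i, j)) = x i"
    and "\<And>j. j \<le> b \<Longrightarrow> (\<Sum>i\<le>a. f (i, j)) = y j"
proof -
  define X Y where "X p = (\<Sum>i<p. x i)" and "Y q = (\<Sum>j<q. y j)" for p q :: nat
  define H where "H p q = min (X p) (Y q)" for p q
  define f where "f = (\<lambda>(i, j). H (Suc i) (Suc j) - H i (Suc j) - H (Suc i) j + H i j)"
  have XS: "X (Suc p) = X p + x p" and YS: "Y (Suc p) = Y p + y p" for p
    by (simp_all add: X_def Y_def)
  have X0: "X 0 = 0" "Y 0 = 0" by (simp_all add: X_def Y_def)
  have monoX: "X p \<le> X q" and monoY: "Y p \<le> Y q" if "p \<le> q" for p q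
    using that x y unfolding X_def Y_def by (auto intro!: sum_mono2)
  have nonneg: "0 \<le> X p" "0 \<le> Y p" for p
    using x y unfolding X_def Y_def by (auto intro!: sum_nonneg)
  have total: "X (Suc a) = Y (Suc b)" using eq by (simp add: X_def Y_def lessThan_Suc_atMost)
  \<comment> \<open>The overlap length. Nonnegativity and the support condition are read off from
    this form, the marginals from the second difference.\<close>
  have f_eq: "f (i, j) = max 0 (min (X (Suc i)) (Y (Suc j)) - max (X i) (Y j))" for i j
    using x[of i] y[of j] by (simp add: f_def H_def XS YS min_def max_def)
  show thesis
  proof
    show "0 \<le> f p" for p by (cases p) (simp add: f_eq)
    show "staircase {p. f p \<noteq> 0}"
      unfolding staircase_def
    proof clarsimp
      fix i j i' j'
      assume nz: "f (i, j) \<noteq> 0" "f (i', j') \<noteq> 0" and "i < i'"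
      show "j \<le> j'"
      proof (rule ccontr)
        assume "\<not> j \<le> j'"
        \<comment> \<open>This closes the impossible cycle
          \<open>Y j < X (Suc i) \<le> X i' < Y (Suc j') \<le> Y j\<close>.\<close>
        then have "X (Suc i) \<le> X i'" "Y (Suc j') \<le> Y j"
          using \<open>i < i'\<close> by (auto intro: monoX monoY)
        moreover have "Y j < X (Suc i)" "X i' < Y (Suc j')"
          using nz unfolding f_eq by (auto simp: max_def min_def split: if_splits)
        ultimately show False by linarith
      qed
    qed
    show "(\<Sum>j\<le>b. f (i, j)) = x i" if "i \<le> a" for i
    proof -
      have "(\<Sum>j\<le>b. f (i, j)) =
          (\<Sum>j<Suc b. (H (Suc i) (Suc j) - H i (Suc j)) - (H (Suc i) j - H i j))"
        unfolding lessThan_Suc_atMost by (intro sum.cong) (simp_all add: f_def)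
      also have "\<dots> = (H (Suc i) (Suc b) - H i (Suc b)) - (H (Suc i) 0 - H i 0)"
        by (rule sum_lessThan_telescope)
      \<comment> \<open>At \<open>0\<close> the minima vanish; at \<open>Suc b\<close> the sum
        \<open>Y\<close> has reached the common total, so the minima are the values of
        \<open>X\<close>.\<close>
      also have "\<dots> = x i"
        using monoX[of "Suc i" "Suc a"] monoX[of i "Suc a"] that nonneg(1)[of i] nonneg(1)[of "Suc i"]
        by (simp add: H_def X0 XS flip: total)
      finally show ?thesis .
    qed
    show "(\<Sum>i\<le>a. f (i, j)) = y j" if "j \<le> b" for j
    proof -
      have "(\<Sum>i\<le>a. f (i, j)) =
          (\<Sum>i<Suc a. (H (Suc i) (Suc j) - H (Suc i) j) - (H i (Suc j) - H i j))"
        unfolding lessThan_Suc_atMost by (intro sum.cong) (simp_all add: f_def)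
      also have "\<dots> = (H (Suc a) (Suc j) - H (Suc a) j) - (H 0 (Suc j) - H 0 j)"
        by (rule sum_lessThan_telescope)
      also have "\<dots> = y j"
        using monoY[of "Suc j" "Suc b"] monoY[of j "Suc b"] that nonneg(2)[of j] nonneg(2)[of "Suc j"]
        by (simp add: H_def X0 YS total)
      finally show ?thesis .
    qed
  qed
qed

subsection \<open>The staircase triangulation\<close>

text \<open>The index types carry no order; enumerating them by initial segments of the naturals
  makes staircases meaningful.\<close>

locale simplex_product =
  fixes g :: "nat \<Rightarrow> 'm::finite" and h :: "nat \<Rightarrow> 'n::finite" and a b :: nat
  assumes bij_g: "bij_betw g {..a} UNIV" and bij_h: "bij_betw h {..b} UNIV"
begin

definition grid :: "(nat \<times> nat) set" where
  "grid = {..a} \<times> {..b}"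

definition vertex :: "nat \<times> nat \<Rightarrow> (real^'m) \<times> (real^'n)" where
  "vertex p = (axis (g (fst p)) 1, axis (h (snd p)) 1)"

lemma finite_grid: "finite grid"
  by (simp add: grid_def)

lemma card_m: "CARD('m) = a + 1" and card_n: "CARD('n) = b + 1"
  using bij_betw_same_card[OF bij_g] bij_betw_same_card[OF bij_h] by simp_all

lemma g_eq_iff: "i \<le> a \<Longrightarrow> i' \<le> a \<Longrightarrow> g i = g i' \<longleftrightarrow> i = i'"
  using bij_betw_imp_inj_on[OF bij_g] by (auto simp: inj_on_def)

lemma h_eq_iff: "j \<le> b \<Longrightarrow> j' \<le> b \<Longrightarrow> h j = h j' \<longleftrightarrow> j = j'"
  using bij_betw_imp_inj_on[OF bij_h] by (auto simp: inj_on_def)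

lemma g_surj: "\<exists>i\<le>a. k = g i"
  using bij_betw_imp_surj_on[OF bij_g] by (metis UNIV_I atMost_iff imageE)

lemma h_surj: "\<exists>j\<le>b. k = h j"
  using bij_betw_imp_surj_on[OF bij_h] by (metis UNIV_I atMost_iff imageE)

lemma inj_on_vertex: "inj_on vertex grid"
  by (rule inj_onI) (auto simp: vertex_def grid_def axis_eq_axis g_eq_iff h_eq_iff)

lemma fst_sum_vertex:
  assumes "i \<le> a"
  shows "fst (\<Sum>p\<in>grid. f p *\<^sub>R vertex p) $ g i = (\<Sum>j\<le>b. f (i, j))"
proof -
  have "fst (\<Sum>p\<in>grid. f p *\<^sub>R vertex p) $ g i = (\<Sum>(i', j)\<in>grid. if i' = i then f (i', j) else 0)"
    using assms unfolding fst_sum sum_component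
    by (intro sum.cong) (auto simp: vertex_def grid_def axis_def g_eq_iff)
  also have "\<dots> = (\<Sum>i'\<le>a. \<Sum>j\<le>b. if i' = i then f (i', j) else 0)"
    unfolding grid_def by (rule sum.cartesian_product[symmetric])
  also have "\<dots> = (\<Sum>i'\<le>a. if i' = i then \<Sum>j\<le>b. f (i', j) else 0)"
    by (intro sum.cong) auto
  finally show ?thesis using assms by simp
qed

lemma snd_sum_vertex:
  assumes "j \<le> b"
  shows "snd (\<Sum>p\<in>grid. f p *\<^sub>R vertex p) $ h j = (\<Sum>i\<le>a. f (i, j))"
proof -
  have "snd (\<Sum>p\<in>grid. f p *\<^sub>R vertex p) $ h j = (\<Sum>(i, j')\<in>grid. if j' = j then f (i, j') else 0)"
    using assms unfolding snd_sum sum_component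
    by (intro sum.cong) (auto simp: vertex_def grid_def axis_def h_eq_iff)
  also have "\<dots> = (\<Sum>i\<le>a. \<Sum>j'\<le>b. if j' = j then f (i, j') else 0)"
    unfolding grid_def by (rule sum.cartesian_product[symmetric])
  also have "\<dots> = (\<Sum>i\<le>a. f (i, j))"
    using assms by (intro sum.cong) auto
  finally show ?thesis .
qed

text \<open>The coordinates of a combination are the row and column sums of its weights, so a point
  is a pair of marginals and its representations are the couplings of that pair.\<close>

lemma sum_vertex_eq_iff:
  "(\<Sum>p\<in>grid. f p *\<^sub>R vertex p) = (\<Sum>p\<in>grid. f' p *\<^sub>R vertex p) \<longleftrightarrow>
    (\<forall>i\<le>a. (\<Sum>j\<le>b. f (i, j)) = (\<Sum>j\<le>b. f' (i, j))) \<and>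
    (\<forall>j\<le>b. (\<Sum>i\<le>a. f (i, j)) = (\<Sum>i\<le>a. f' (i, j)))"
  (is "?x = ?y \<longleftrightarrow> _")
proof -
  have "x = y \<longleftrightarrow> (\<forall>i\<le>a. fst x $ g i = fst y $ g i) \<and> (\<forall>j\<le>b. snd x $ h j = snd y $ h j)" for x y
  proof
    assume eq: "(\<forall>i\<le>a. fst x $ g i = fst y $ g i) \<and> (\<forall>j\<le>b. snd x $ h j = snd y $ h j)"
    have "fst x $ k = fst y $ k" "snd x $ l = snd y $ l" for k l
      using eq g_surj[of k] h_surj[of l] by auto
    then show "x = y" by (simp add: prod_eq_iff vec_eq_iff)
  qed simp
  from this[of ?x ?y] show ?thesis by (simp add: fst_sum_vertex snd_sum_vertex)
qed

lemma staircase_combination_unique: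
  assumes "\<And>p. 0 \<le> f p" "staircase {p. f p \<noteq> 0}" "\<And>p. 0 \<le> f' p" "staircase {p. f' p \<noteq> 0}"
    and "(\<Sum>p\<in>grid. f p *\<^sub>R vertex p) = (\<Sum>p\<in>grid. f' p *\<^sub>R vertex p)" and "p \<in> grid"
  shows "f p = f' p"
proof -
  obtain i j where "p = (i, j)" "i \<le> a" "j \<le> b" using assms(6) by (auto simp: grid_def)
  then show ?thesis
    using assms(5) staircase_coupling_unique[OF assms(1-4), where a=a and b=b]
    unfolding sum_vertex_eq_iff by blast
qed

text \<open>Weights are extended by zero off \<open>C\<close>, so that representations from
  different cells become sums over the same index set.\<close>

lemma mem_cell_iff:
  assumes "C \<subseteq> grid"
  shows "z \<in> convex hull (vertex ` C) \<longleftrightarrow>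
    (\<exists>f. (\<forall>p. 0 \<le> f p) \<and> (\<forall>p. p \<notin> C \<longrightarrow> f p = 0) \<and> (\<Sum>p\<in>grid. f p) = 1 \<and>
      (\<Sum>p\<in>grid. f p *\<^sub>R vertex p) = z)"
proof
  have fin: "finite C" using assms finite_grid finite_subset by blast
  have inj: "inj_on vertex C" using assms inj_on_vertex inj_on_subset by blast
  {
    assume "z \<in> convex hull (vertex ` C)"
    then obtain u where u: "\<forall>x\<in>vertex ` C. 0 \<le> u x" "sum u (vertex ` C) = 1"
      "(\<Sum>x\<in>vertex ` C. u x *\<^sub>R x) = z"
      using fin by (auto simp: convex_hull_finite)
    let ?f = "\<lambda>p. if p \<in> C then u (vertex p) else 0"
    have "sum ?f grid = (\<Sum>p\<in>C. u (vertex p))"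
      using assms finite_grid by (intro sum.mono_neutral_cong_right) auto
    moreover have "(\<Sum>p\<in>grid. ?f p *\<^sub>R vertex p) = (\<Sum>p\<in>C. u (vertex p) *\<^sub>R vertex p)"
      using assms finite_grid by (intro sum.mono_neutral_cong_right) auto
    ultimately show "\<exists>f. (\<forall>p. 0 \<le> f p) \<and> (\<forall>p. p \<notin> C \<longrightarrow> f p = 0) \<and> (\<Sum>p\<in>grid. f p) = 1 \<and>
      (\<Sum>p\<in>grid. f p *\<^sub>R vertex p) = z"
      using u inj by (intro exI[of _ ?f]) (simp add: sum.reindex)
  next
    assume "\<exists>f. (\<forall>p. 0 \<le> f p) \<and> (\<forall>p. p \<notin> C \<longrightarrow> f p = 0) \<and> (\<Sum>p\<in>grid. f p) = 1 \<and>
      (\<Sum>p\<in>grid. f p *\<^sub>R vertex p) = z"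
    then obtain f where f: "\<And>p. 0 \<le> f p" "\<And>p. p \<notin> C \<Longrightarrow> f p = 0" "(\<Sum>p\<in>grid. f p) = 1"
      "(\<Sum>p\<in>grid. f p *\<^sub>R vertex p) = z" by blast
    have "sum f grid = sum f C"
      using assms finite_grid f(2) by (intro sum.mono_neutral_cong_right) auto
    moreover have "(\<Sum>p\<in>grid. f p *\<^sub>R vertex p) = (\<Sum>p\<in>C. f p *\<^sub>R vertex p)"
      using assms finite_grid f(2) by (intro sum.mono_neutral_cong_right) auto
    moreover have "(\<Sum>p\<in>C. f p *\<^sub>R vertex p) \<in> convex hull (vertex ` C)" if "sum f C = 1"
      using that fin f(1) by (intro convex_sum) (auto simp: hull_inc)
    ultimately show "z \<in> convex hull (vertex ` C)" using f(3,4) by simp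
  }
qed

text \<open>A common point has one coupling supported in \<open>C\<close> and one in
  \<open>D\<close>. By uniqueness they agree, so the support lies in both sets.\<close>

lemma cell_Int:
  assumes "staircase C" "C \<subseteq> grid" "staircase D" "D \<subseteq> grid"
  shows "convex hull (vertex ` C) \<inter> convex hull (vertex ` D) = convex hull (vertex ` (C \<inter> D))"
proof
  show "convex hull (vertex ` C) \<inter> convex hull (vertex ` D) \<subseteq> convex hull (vertex ` (C \<inter> D))"
  proof
    fix z assume "z \<in> convex hull (vertex ` C) \<inter> convex hull (vertex ` D)"
    then obtain f f' where f: "\<And>p. 0 \<le> f p" "\<And>p. p \<notin> C \<Longrightarrow> f p = 0" "(\<Sum>p\<in>grid. f p) = 1"
        "(\<Sum>p\<in>grid. f p *\<^sub>R vertex p) = z"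
      and f': "\<And>p. 0 \<le> f' p" "\<And>p. p \<notin> D \<Longrightarrow> f' p = 0"
        "(\<Sum>p\<in>grid. f' p *\<^sub>R vertex p) = z"
      unfolding Int_iff mem_cell_iff[OF assms(2)] mem_cell_iff[OF assms(4)] by blast
    have "{p. f p \<noteq> 0} \<subseteq> C" "{p. f' p \<noteq> 0} \<subseteq> D"
      using f(2) f'(2) by blast+
    then have "staircase {p. f p \<noteq> 0}" "staircase {p. f' p \<noteq> 0}"
      using assms staircase_subset by blast+
    note unique = staircase_combination_unique[OF f(1) this(1) f'(1) this(2)]
    have eq: "f p = f' p" if "p \<in> grid" for p
      by (rule unique) (simp_all add: f(4) f'(3) that)
    have "f p = 0" if "p \<notin> C \<inter> D" for p
      using that f(2)[of p] f'(2)[of p] eq[of p] assms(2) by (cases "p \<in> C") auto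
    moreover have "C \<inter> D \<subseteq> grid" using assms(2) by blast
    ultimately show "z \<in> convex hull (vertex ` (C \<inter> D))"
      using f(1,3,4) mem_cell_iff[of "C \<inter> D" z] by blast
  qed
  show "convex hull (vertex ` (C \<inter> D)) \<subseteq> convex hull (vertex ` C) \<inter> convex hull (vertex ` D)"
    by (intro Int_greatest hull_mono) auto
qed

text \<open>The positive and negative parts of a dependency are two staircase couplings of the same
  point. Uniqueness makes them equal, yet at most one of them is nonzero at any given
  vertex.\<close>

lemma affine_independent_staircase:
  assumes "staircase C" "C \<subseteq> grid"
  shows "\<not> affine_dependent (vertex ` C)"
proof
  have fin: "finite C" using assms finite_grid finite_subset by blast
  have inj: "inj_on vertex C" using assms inj_on_vertex inj_on_subset by blast
  assume "affine_dependent (vertex ` C)"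
  then obtain U p where U: "p \<in> C" "U (vertex p) \<noteq> 0" "(\<Sum>v\<in>vertex ` C. U v *\<^sub>R v) = 0"
    using fin by (auto simp: affine_dependent_explicit_finite)
  define f where "f q = (if q \<in> C then max 0 (U (vertex q)) else 0)" for q
  define f' where "f' q = (if q \<in> C then max 0 (- U (vertex q)) else 0)" for q
  have "(\<Sum>q\<in>grid. f q *\<^sub>R vertex q) - (\<Sum>q\<in>grid. f' q *\<^sub>R vertex q) =
      (\<Sum>q\<in>grid. (if q \<in> C then U (vertex q) else 0) *\<^sub>R vertex q)"
    unfolding sum_subtractf[symmetric] scaleR_left_diff_distrib[symmetric]
    by (intro sum.cong) (auto simp: f_def f'_def max_def)
  also have "\<dots> = (\<Sum>q\<in>C. U (vertex q) *\<^sub>R vertex q)"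
    using assms finite_grid by (intro sum.mono_neutral_cong_right) auto
  also have "\<dots> = 0" using U(3) inj by (simp add: sum.reindex)
  finally have "(\<Sum>q\<in>grid. f q *\<^sub>R vertex q) = (\<Sum>q\<in>grid. f' q *\<^sub>R vertex q)" by simp
  moreover have "staircase {q. f q \<noteq> 0}" "staircase {q. f' q \<noteq> 0}"
    by (auto intro!: staircase_subset[OF assms(1)] simp: f_def f'_def split: if_splits)
  moreover have "0 \<le> f q" "0 \<le> f' q" for q by (simp_all add: f_def f'_def)
  ultimately have "f p = f' p"
    using staircase_combination_unique[of f f' p] U(1) assms(2) by blast
  then show False using U by (simp add: f_def f'_def max_def split: if_splits)
qed

text \<open>Any convex representation is replaced by the staircase coupling with the same marginals,
  whose support extends to a lattice path.\<close>

lemma cells_cover: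
  assumes "z \<in> convex hull (vertex ` grid)"
  shows "\<exists>C\<in>lattice_paths a b. z \<in> convex hull (vertex ` C)"
proof -
  obtain f where f: "\<And>p. 0 \<le> f p" "(\<Sum>p\<in>grid. f p) = 1" "(\<Sum>p\<in>grid. f p *\<^sub>R vertex p) = z"
    using assms mem_cell_iff[of grid z] by blast
  define x y where "x i = (\<Sum>j\<le>b. f (i, j))" and "y j = (\<Sum>i\<le>a. f (i, j))" for i j
  have "(\<Sum>i\<le>a. x i) = (\<Sum>j\<le>b. y j)" unfolding x_def y_def by (rule sum.swap)
  then obtain f' where f': "\<And>p. 0 \<le> f' p" "staircase {p. f' p \<noteq> 0}"
    "\<And>i. i \<le> a \<Longrightarrow> (\<Sum>j\<le>b. f' (i, j)) = x i" "\<And>j. j \<le> b \<Longrightarrow> (\<Sum>i\<le>a. f' (i, j)) = y j"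
    using staircase_coupling_exists[of x y a b] f(1) by (auto simp: x_def y_def sum_nonneg)
  \<comment> \<open>The marginal conditions say nothing about \<open>f'\<close> off the grid, so it
    is cut off there.\<close>
  let ?f = "\<lambda>p. if p \<in> grid then f' p else 0"
  have z: "(\<Sum>p\<in>grid. ?f p *\<^sub>R vertex p) = z"
  proof -
    have "(\<Sum>p\<in>grid. f' p *\<^sub>R vertex p) = z"
      unfolding f(3)[symmetric] sum_vertex_eq_iff using f'(3,4) by (simp add: x_def y_def)
    then show ?thesis by simp
  qed
  have one: "(\<Sum>p\<in>grid. ?f p) = 1"
  proof -
    have "(\<Sum>p\<in>grid. f' p) = (\<Sum>i\<le>a. \<Sum>j\<le>b. f' (i, j))"
      unfolding grid_def sum.cartesian_product by simp
    also have "\<dots> = (\<Sum>i\<le>a. \<Sum>j\<le>b. f (i, j))" using f'(3) by (simp add: x_def)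
    also have "\<dots> = (\<Sum>p\<in>grid. f p)"
      unfolding grid_def sum.cartesian_product by simp
    finally show ?thesis using f(2) by simp
  qed
  have "staircase ({p. f' p \<noteq> 0} \<inter> grid)"
    using f'(2) by (rule staircase_subset) simp
  then obtain D where D: "D \<in> lattice_paths a b" "{p. f' p \<noteq> 0} \<inter> grid \<subseteq> D"
    using staircase_subset_lattice_path[of _ a b] by (auto simp: grid_def)
  moreover have "D \<subseteq> grid" using D(1) lattice_path_subset_grid by (simp add: grid_def)
  ultimately have "z \<in> convex hull (vertex ` D)"
    using f'(1) z one by (subst mem_cell_iff) (auto intro!: exI[of _ ?f])
  then show ?thesis using D(1) by blast
qed

lemma product_eq_hull:
  "(std_simplex :: (real^'m) set) \<times> (std_simplex :: (real^'n) set) = convex hull (vertex ` grid)"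
proof -
  have "vertex ` grid = range (\<lambda>i. axis i 1) \<times> range (\<lambda>j. axis j 1)"
  proof
    show "vertex ` grid \<subseteq> range (\<lambda>i. axis i 1) \<times> range (\<lambda>j. axis j 1)"
      by (auto simp: vertex_def)
    show "range (\<lambda>i. axis i 1) \<times> range (\<lambda>j. axis j 1) \<subseteq> vertex ` grid"
    proof clarify
      fix k l
      obtain i j where "i \<le> a" "k = g i" "j \<le> b" "l = h j" using g_surj h_surj by metis
      then show "(axis k 1, axis l 1) \<in> vertex ` grid"
        by (intro image_eqI[of _ _ "(i, j)"]) (auto simp: vertex_def grid_def)
    qed
  qed
  then show ?thesis by (simp add: std_simplex_def convex_hull_Times)
qed

end

section \<open>Vertices, dimension and triangulation of the product\<close>

lemma axis_extreme_point_std_simplex: "axis i 1 extreme_point_of (std_simplex :: (real^'k) set)"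
proof -
  have "range (\<lambda>i. axis i 1 :: real^'k) \<subseteq> Basis" by auto
  then have "independent (range (\<lambda>i. axis i 1 :: real^'k))"
    using independent_Basis independent_mono by blast
  then have "\<not> affine_dependent (range (\<lambda>i. axis i 1 :: real^'k))"
    using affine_dependent_imp_dependent by blast
  then show ?thesis
    unfolding std_simplex_def by (simp add: extreme_point_of_convex_hull_affine_independent)
qed

context simplex_product
begin

abbreviation product :: "((real^'m) \<times> (real^'n)) set" where
  "product \<equiv> std_simplex \<times> std_simplex"

lemma vertices_product: "vertices product = vertex ` grid"
proof
  show "vertices product \<subseteq> vertex ` grid"
    unfolding vertices_def product_eq_hull using extreme_point_of_convex_hull by blast
  show "vertex ` grid \<subseteq> vertices product"
  proof
    fix v assume "v \<in> vertex ` grid"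
    then obtain i j where v: "v = (axis i 1, axis j 1)" by (auto simp: vertex_def)
    \<comment> \<open>Extreme points are one-point faces, and products of faces are faces of the
      product.\<close>
    have "{axis i 1} \<times> {axis j 1} face_of product"
      unfolding face_of_Times_eq face_of_singleton
      using axis_extreme_point_std_simplex[of i] axis_extreme_point_std_simplex[of j] by simp
    then show "v \<in> vertices product" by (simp add: v vertices_def flip: face_of_singleton)
  qed
qed

lemma staircase_cell:
  assumes "C \<in> lattice_paths a b"
  shows "C \<subseteq> grid" "staircase C" "\<not> affine_dependent (vertex ` C)"
    "int (a + b) simplex (convex hull (vertex ` C))"
proof -
  show *: "C \<subseteq> grid" "staircase C"
    using lattice_path_subset_grid[OF assms] staircase_lattice_path[OF assms]
    by (simp_all add: grid_def)
  then show indep: "\<not> affine_dependent (vertex ` C)" by (simp add: affine_independent_staircase)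
  have "card (vertex ` C) = a + b + 1"
    using card_image[OF inj_on_subset[OF inj_on_vertex]] * card_lattice_path[OF assms] by metis
  then show "int (a + b) simplex (convex hull (vertex ` C))"
    unfolding simplex_def using indep by auto
qed

text \<open>From below, the product contains a staircase cell. From above, it lies in two
  hyperplanes: the coordinates of each factor sum to 1.\<close>

lemma aff_dim_product: "aff_dim product = int (a + b)"
proof (rule antisym)
  \<comment> \<open>Extending the empty staircase shows that a path exists.\<close>
  obtain C where "C \<in> lattice_paths a b"
    using staircase_subset_lattice_path[of "{}" a b] by (auto simp: staircase_def)
  note C = staircase_cell[OF this]
  have "convex hull (vertex ` C) \<subseteq> product"
    unfolding product_eq_hull using C by (intro hull_mono image_mono)
  then show "int (a + b) \<le> aff_dim product"
    using aff_dim_simplex[OF C(4)] aff_dim_subset by metis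
next
  let ?p = "(\<chi> i. 1, 0) :: (real^'m) \<times> (real^'n)" and ?q = "(0, \<chi> i. 1) :: (real^'m) \<times> (real^'n)"
  let ?H = "{x. ?p \<bullet> x = 1}"
  have "product \<subseteq> ?H \<inter> {x. ?q \<bullet> x = 1}"
    unfolding product_eq_hull
    by (intro hull_minimal convex_Int convex_hyperplane) (auto simp: vertex_def inner_axis)
  then have "aff_dim product \<le> aff_dim (?H \<inter> {x. ?q \<bullet> x = 1})" by (rule aff_dim_subset)
  also have "\<dots> \<le> aff_dim ?H - 1"
  proof -
    \<comment> \<open>This point of the first hyperplane misses the second, so intersecting lowers
      the dimension.\<close>
    have "(axis (g 0) 1, 0) \<in> ?H - {x. ?q \<bullet> x = 1}" by (auto simp: inner_axis)
    then have "\<not> ?H \<subseteq> {x. ?q \<bullet> x = 1}" by blast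
    \<comment> \<open>Covers the branch of the dimension formula for an empty intersection, whose
      dimension is -1.\<close>
    moreover have "-1 \<le> aff_dim ?H - 1" using aff_dim_hyperplane[of ?p 1]
      by (simp add: vec_eq_iff zero_prod_def)
    ultimately show ?thesis
      unfolding aff_dim_affine_Int_hyperplane[OF affine_hyperplane] by simp
  qed
  also have "aff_dim ?H = int (DIM((real^'m) \<times> (real^'n))) - 1"
    by (simp add: aff_dim_hyperplane vec_eq_iff zero_prod_def card_m of_nat_diff)
  finally show "aff_dim product \<le> int (a + b)" by (simp add: card_m card_n)
qed

lemma staircase_triangulation:
  "\<exists>V. vertex_triangulates V product \<and> card V = (a + b) choose a"
proof (intro exI conjI)
  let ?cell = "\<lambda>C. convex hull (vertex ` C)"
  let ?V = "?cell ` lattice_paths a b"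
  \<comment> \<open>Distinct paths give distinct cells: the extreme points of a cell recover its
    vertex set, and \<open>vertex\<close> is injective on the grid.\<close>
  have "C = D" if "C \<in> lattice_paths a b" "D \<in> lattice_paths a b" "?cell C = ?cell D" for C D
  proof -
    have "x \<in> vertex ` C \<longleftrightarrow> x \<in> vertex ` D" for x
      using extreme_point_of_convex_hull_affine_independent[OF staircase_cell(3)] that by metis
    then have "vertex ` C = vertex ` D" by blast
    then show ?thesis
      using inj_on_image_eq_iff[OF inj_on_vertex] staircase_cell(1) that by metis
  qed
  then have "inj_on ?cell (lattice_paths a b)" by (rule inj_onI)
  then show "card ?V = (a + b) choose a" by (simp add: card_image card_lattice_paths)
  \<comment> \<open>The intersection is spanned by a subset of the affinely independent vertices of
    one cell, hence is a face of it.\<close>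
  have face: "?cell C \<inter> ?cell D face_of ?cell C"
    if "C \<in> lattice_paths a b" "D \<in> lattice_paths a b" for C D
  proof -
    have "?cell C \<inter> ?cell D = ?cell (C \<inter> D)"
      using staircase_cell(1,2) that by (intro cell_Int) auto
    moreover have "vertex ` (C \<inter> D) \<subseteq> vertex ` C" by auto
    ultimately show ?thesis
      using face_of_convex_hull_affine_independent[OF staircase_cell(3)[OF that(1)]] by blast
  qed
  have "triangulation ?V"
    unfolding triangulation_def using staircase_cell(4) face by (auto simp: finite_lattice_paths)
  moreover have "\<Union>?V = product"
  proof
    show "\<Union>?V \<subseteq> product"
      unfolding product_eq_hull by (intro UN_least hull_mono image_mono staircase_cell(1))
    show "product \<subseteq> \<Union>?V"
      unfolding product_eq_hull using cells_cover by auto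
  qed
  moreover have "vertices (?cell C) \<subseteq> vertices product" if "C \<in> lattice_paths a b" for C
  proof -
    have "vertices (?cell C) \<subseteq> vertex ` C"
      unfolding vertices_def using extreme_point_of_convex_hull by blast
    then show ?thesis using staircase_cell(1)[OF that] by (auto simp: vertices_product)
  qed
  ultimately show "vertex_triangulates ?V product"
    using staircase_cell(4) by (auto simp: vertex_triangulates_def triangulates_def aff_dim_product)
qed

end

subsection \<open>Determinants of bipartite incidence matrices\<close>

text \<open>A copy of \<open>'m + 'n\<close> carrying a well-order, which the change of variables formula for Lebesgue
  measure on \<open>real^'k\<close> demands of the index type.\<close>

typedef ('m, 'n) index = "UNIV :: ('m + 'n) set" by simp

instance index :: (finite, finite) finite
proof
  show "finite (UNIV :: ('a, 'b) index set)"
    unfolding type_definition.Abs_image[OF type_definition_index, symmetric] by simp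
qed

lemma card_index: "CARD(('m::finite, 'n::finite) index) = CARD('m) + CARD('n)"
  by (simp add: type_definition.card[OF type_definition_index])

instantiation index :: (finite, finite) wellorder
begin

definition less_eq_index :: "('a, 'b) index \<Rightarrow> ('a, 'b) index \<Rightarrow> bool" where
  "i \<le> j \<longleftrightarrow> to_nat (Rep_index i) \<le> to_nat (Rep_index j)"

definition less_index :: "('a, 'b) index \<Rightarrow> ('a, 'b) index \<Rightarrow> bool" where
  "i < j \<longleftrightarrow> to_nat (Rep_index i) < to_nat (Rep_index j)"

instance
proof
  fix P :: "('a, 'b) index \<Rightarrow> bool" and i
  assume step: "\<And>i. (\<And>j. j < i \<Longrightarrow> P j) \<Longrightarrow> P i"
  show "P i"
    by (rule measure_induct_rule[where f = "\<lambda>i. to_nat (Rep_index i)"])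
      (rule step, simp add: less_index_def)
qed (auto simp: less_eq_index_def less_index_def Rep_index_inject)

end

text \<open>Rows of the incidence matrix of the complete bipartite graph with sides \<open>L\<close>
  and its complement.\<close>

definition edge_vectors :: "'k::finite set \<Rightarrow> (real^'k) set" where
  "edge_vectors L = {axis i 1 + axis j 1 | i j. i \<in> L \<and> j \<notin> L}"

lemma det_Ints:
  fixes A :: "real^'k^'k"
  assumes "\<And>i j. A $ i $ j \<in> \<int>"
  shows "det A \<in> \<int>"
  unfolding det_def using assms by (intro Ints_sum Ints_mult Ints_prod) auto

text \<open>The set \<open>S\<close> of coordinate vectors that are integral combinations of the rows is closed
  under passing along the edges occurring as rows. If it were not everything, the functional
  summing the remaining coordinates, with opposite signs on the two sides, would vanish on all
  rows, contradicting invertibility. So the matrix has an integral left inverse.\<close>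

lemma det_edge_rows_unimodular:
  fixes r :: "'k::finite \<Rightarrow> real^'k"
  assumes rows: "\<And>k. r k \<in> insert (axis i0 1) (edge_vectors L)" and i0: "i0 \<in> L"
    and nz: "det (\<chi> k. r k) \<noteq> 0"
  shows "\<bar>det (\<chi> k. r k)\<bar> = 1"
proof -
  define M where "M = (\<chi> k. r k)"
  define Z where "Z = {v. \<exists>c. (\<forall>k. c k \<in> \<int>) \<and> v = (\<Sum>k\<in>UNIV. c k *\<^sub>R r k)}"
  have rZ: "r k \<in> Z" for k
    unfolding Z_def by (rule CollectI, rule exI[of _ "\<lambda>l. if l = k then 1 else 0"])
      (simp add: if_distrib[of "\<lambda>u. u *\<^sub>R _"] cong: if_cong)
  have dZ: "u - v \<in> Z" if "u \<in> Z" "v \<in> Z" for u v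
  proof -
    from that obtain c d where "\<forall>k. c k \<in> \<int>" "u = (\<Sum>k\<in>UNIV. c k *\<^sub>R r k)"
      "\<forall>k. d k \<in> \<int>" "v = (\<Sum>k\<in>UNIV. d k *\<^sub>R r k)" unfolding Z_def by blast
    then show ?thesis unfolding Z_def
      by (intro CollectI exI[of _ "\<lambda>k. c k - d k"]) (auto simp: scaleR_left_diff_distrib sum_subtractf)
  qed
  define S where "S = {i. axis i 1 \<in> Z}"
  define \<phi> :: "real^'k" where
    "\<phi> = (\<chi> i. if i \<in> S then 0 else if i \<in> L then 1 else -1)"
  have "r k \<bullet> \<phi> = 0" for k
  proof (cases "r k = axis i0 1")
    case True
    then have "i0 \<in> S" using rZ[of k] by (simp add: S_def)
    then show ?thesis using True by (simp add: inner_axis' \<phi>_def)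
  next
    case False
    then obtain i j where ij: "r k = axis i 1 + axis j 1" "i \<in> L" "j \<notin> L"
      using rows[of k] unfolding edge_vectors_def by auto
    \<comment> \<open>The sum of the two unit vectors is a row, so subtracting one of them from it
      inside \<open>Z\<close> leaves the other.\<close>
    have "i \<in> S \<longleftrightarrow> j \<in> S"
      using dZ[OF rZ[of k], of "axis i 1"] dZ[OF rZ[of k], of "axis j 1"] ij by (auto simp: S_def)
    then show ?thesis using ij by (auto simp: inner_add_left inner_axis' \<phi>_def)
  qed
  then have "M *v \<phi> = 0"
    by (simp add: M_def matrix_vector_mult_def vec_eq_iff inner_vec_def)
  moreover have "invertible M" using nz by (simp add: M_def invertible_det_nz)
  ultimately have "\<phi> = 0"
    by (metis invertible_def matrix_left_invertible_ker)
  then have "S = UNIV"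
    by (auto simp: \<phi>_def vec_eq_iff split: if_splits)
  then have "\<forall>i. \<exists>c. (\<forall>k. c k \<in> \<int>) \<and> (axis i 1 :: real^'k) = (\<Sum>k\<in>UNIV. c k *\<^sub>R r k)"
    unfolding S_def Z_def by blast
  then obtain c where c: "\<And>i k. c i k \<in> \<int>" "\<And>i. (axis i 1 :: real^'k) = (\<Sum>k\<in>UNIV. c i k *\<^sub>R r k)"
    by metis
  \<comment> \<open>The coefficients form an integral left inverse. Both determinants are then
    integers with product 1, hence units.\<close>
  define N where "N = (\<chi> i k. c i k)"
  have "(N ** M) $ i $ j = axis i 1 $ j" for i j
    unfolding c(2) by (simp add: N_def M_def matrix_matrix_mult_def)
  then have "N ** M = mat 1" by (auto simp: vec_eq_iff mat_def axis_def)
  then have "det N * det M = 1" by (metis det_I det_mul)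
  moreover have "det N \<in> \<int>" using c by (intro det_Ints) (simp add: N_def)
  moreover have "det M \<in> \<int>"
  proof (rule det_Ints)
    show "M $ k $ j \<in> \<int>" for k j
      using rows[of k] by (auto simp: M_def edge_vectors_def axis_def)
  qed
  ultimately obtain m n :: int where mn: "det N = of_int m" "det M = of_int n"
    by (meson Ints_cases)
  with \<open>det N * det M = 1\<close> have "n * m = 1"
    by (metis mult.commute of_int_1 of_int_eq_iff of_int_mult)
  then have "n = 1 \<or> n = - 1" by (simp add: zmult_eq_1_iff) blast
  then show ?thesis using mn unfolding M_def by auto
qed

text \<open>The determinant is affine in each row separately, so in each row the bound cuts out a
  convex set. Rows are moved from \<open>V\<close> into its hull one at a time.\<close>

lemma abs_det_convex_hull_le:
  fixes r :: "'k::finite \<Rightarrow> real^'k"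
  assumes V: "\<And>s. (\<And>k. s k \<in> V) \<Longrightarrow> \<bar>det (\<chi> k. s k)\<bar> \<le> B"
    and r: "\<And>k. r k \<in> convex hull V"
  shows "\<bar>det (\<chi> k. r k)\<bar> \<le> B"
proof -
  \<comment> \<open>\<open>K\<close> collects the rows already allowed to range over the hull; the
    others stay in \<open>V\<close>.\<close>
  have "\<bar>det (\<chi> k. s k)\<bar> \<le> B"
    if "finite K" "\<And>k. k \<in> K \<Longrightarrow> s k \<in> convex hull V" "\<And>k. k \<notin> K \<Longrightarrow> s k \<in> V" for K s
    using that
  proof (induction K arbitrary: s rule: finite_induct)
    case empty
    then show ?case by (intro V) auto
  next
    case (insert l K)
    let ?d = "\<lambda>v. det (\<chi> k. if k = l then v else s k)"
    have "convex {v. \<bar>?d v\<bar> \<le> B}"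
    proof (rule convexI, simp)
      fix v w and t u :: real
      assume *: "\<bar>?d v\<bar> \<le> B" "\<bar>?d w\<bar> \<le> B" "0 \<le> t" "0 \<le> u" "t + u = 1"
      have "?d (t *\<^sub>R v + u *\<^sub>R w) = t * ?d v + u * ?d w"
        unfolding scalar_mult_eq_scaleR[symmetric] det_row_add det_row_mul ..
      also have "\<bar>\<dots>\<bar> \<le> t * \<bar>?d v\<bar> + u * \<bar>?d w\<bar>"
        using abs_triangle_ineq[of "t * ?d v" "u * ?d w"] *(3,4) by (simp add: abs_mult)
      also have "\<dots> \<le> t * B + u * B"
        using *(1-4) by (intro add_mono mult_left_mono)
      also have "\<dots> = B" using *(5) by (metis distrib_right mult_1)
      finally show "\<bar>?d (t *\<^sub>R v + u *\<^sub>R w)\<bar> \<le> B" .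
    qed
    moreover have "V \<subseteq> {v. \<bar>?d v\<bar> \<le> B}"
    proof
      fix v assume "v \<in> V"
      then have "\<bar>det (\<chi> k. (s(l := v)) k)\<bar> \<le> B"
        using insert.prems insert.hyps by (intro insert.IH) auto
      then show "v \<in> {v. \<bar>?d v\<bar> \<le> B}" by (simp add: fun_upd_def)
    qed
    ultimately have "convex hull V \<subseteq> {v. \<bar>?d v\<bar> \<le> B}"
      by (rule hull_minimal[rotated])
    then have "\<bar>?d (s l)\<bar> \<le> B" using insert.prems by auto
    moreover have "(\<chi> k. if k = l then s l else s k) = (\<chi> k. s k)" by (simp add: vec_eq_iff)
    ultimately show ?case by simp
  qed
  from this[of UNIV r] r show ?thesis by simp
qed

subsection \<open>Volumes of cones\<close>

text \<open>Adjoining the origin and an apex \<open>w\<close> turns the cells of a polytope of codimension 2 into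
  full-dimensional simplices, so that Lebesgue measure can compare them.\<close>

definition cone_over :: "'v::real_vector \<Rightarrow> 'v set \<Rightarrow> 'v set" where
  "cone_over w T = convex hull (insert 0 (insert w T))"

lemma mem_cone_over_iff:
  assumes "convex T" and "T \<noteq> {}"
  shows "x \<in> cone_over w T \<longleftrightarrow>
    (\<exists>u v t. 0 \<le> u \<and> 0 \<le> v \<and> u + v \<le> 1 \<and> t \<in> T \<and> x = u *\<^sub>R w + v *\<^sub>R t)"
proof
  assume "x \<in> cone_over w T"
  then obtain r s y where s: "0 \<le> r" "0 \<le> s" "r + s = 1" "x = r *\<^sub>R 0 + s *\<^sub>R y"
    "y \<in> convex hull (insert w T)"
    unfolding cone_over_def convex_hull_insert[OF insert_not_empty] by blast
  from s(5) obtain u v t where "0 \<le> u" "0 \<le> v" "u + v = 1" "t \<in> T" "y = u *\<^sub>R w + v *\<^sub>R t"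
    unfolding convex_hull_insert[OF assms(2)] hull_same[of convex, OF assms(1)] by blast
  moreover from this s have "s * u + s * v \<le> 1" by (simp flip: distrib_left)
  ultimately show "\<exists>u v t. 0 \<le> u \<and> 0 \<le> v \<and> u + v \<le> 1 \<and> t \<in> T \<and> x = u *\<^sub>R w + v *\<^sub>R t"
    using s by (intro exI[of _ "s * u"] exI[of _ "s * v"] exI[of _ t]) (simp add: scaleR_add_right)
next
  assume "\<exists>u v t. 0 \<le> u \<and> 0 \<le> v \<and> u + v \<le> 1 \<and> t \<in> T \<and> x = u *\<^sub>R w + v *\<^sub>R t"
  then obtain u v t where *: "0 \<le> u" "0 \<le> v" "u + v \<le> 1" "t \<in> T" "x = u *\<^sub>R w + v *\<^sub>R t"
    by blast
  \<comment> \<open>The remaining weight \<open>1 - u - v\<close> goes to the origin.\<close>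
  then have "x \<in> convex hull {0, w, t}"
    unfolding convex_hull_3
    by (intro CollectI exI[of _ "1 - u - v"] exI[of _ u] exI[of _ v]) simp
  then show "x \<in> cone_over w T"
    unfolding cone_over_def by (rule subsetD[OF hull_mono, rotated]) (use * in auto)
qed

text \<open>A cone point involves a single base point \<open>t\<close>, which lies in some member of
  \<open>F\<close>. Convexity of the union makes this description available for the whole
  cone.\<close>

lemma cone_over_Union:
  assumes "\<And>T. T \<in> F \<Longrightarrow> convex T \<and> T \<noteq> {}" and "convex (\<Union>F)" and "F \<noteq> {}"
  shows "cone_over w (\<Union>F) = (\<Union>T\<in>F. cone_over w T)"
proof -
  have "\<Union>F \<noteq> {}" using assms(1,3) by blast
  then have "x \<in> cone_over w (\<Union>F) \<longleftrightarrow> (\<exists>T\<in>F. x \<in> cone_over w T)" for x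
    using assms(1) unfolding mem_cone_over_iff[OF assms(2) \<open>\<Union>F \<noteq> {}\<close>]
    by (auto simp: mem_cone_over_iff)
  then show ?thesis by blast
qed

text \<open>\<open>P\<close> and \<open>Q\<close> stand for the coordinate sums over the two sides.
  On \<open>u *\<^sub>R w + v *\<^sub>R t\<close> with \<open>t\<close> in \<open>H\<close>,
  \<open>Q\<close> reads off \<open>v\<close> and \<open>P\<close> reads off
  \<open>u + v\<close>.\<close>

context
  fixes P Q w :: "'v::euclidean_space" and H
  assumes w: "P \<bullet> w = 1" "Q \<bullet> w = 0" and H: "\<And>x. x \<in> H \<Longrightarrow> P \<bullet> x = 1 \<and> Q \<bullet> x = 1"
begin

text \<open>The functionals show that both representations of a common point have the same
  coefficients, so either the base points agree or their coefficient is zero.\<close>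

lemma cone_over_Int_subset_span:
  assumes "convex S" "S \<noteq> {}" "S \<subseteq> H" "convex T" "T \<noteq> {}" "T \<subseteq> H"
  shows "cone_over w S \<inter> cone_over w T \<subseteq> span (insert w (S \<inter> T))"
proof
  fix x assume "x \<in> cone_over w S \<inter> cone_over w T"
  then have "x \<in> cone_over w S" "x \<in> cone_over w T" by auto
  then obtain u v s u' v' t where *: "s \<in> S" "t \<in> T"
    "x = u *\<^sub>R w + v *\<^sub>R s" "x = u' *\<^sub>R w + v' *\<^sub>R t"
    unfolding mem_cone_over_iff[OF assms(1,2)] mem_cone_over_iff[OF assms(4,5)] by blast
  moreover have "P \<bullet> s = 1" "Q \<bullet> s = 1" "P \<bullet> t = 1" "Q \<bullet> t = 1"
    using * assms(3,6) H by auto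
  ultimately have "Q \<bullet> x = v" "Q \<bullet> x = v'" "P \<bullet> x = u + v" "P \<bullet> x = u' + v'"
    using w by (metis add_0 inner_add_right inner_scaleR_right mult.right_neutral mult_zero_right)+
  then have "v = v'" "u = u'" by auto
  with * have "v = 0 \<or> s = t" by auto
  moreover have "w \<in> span (insert w (S \<inter> T))" by (simp add: span_base)
  moreover have "s \<in> span (insert w (S \<inter> T))" if "s = t" using * that by (simp add: span_base)
  ultimately show "x \<in> span (insert w (S \<inter> T))"
    unfolding *(3) by (metis span_add span_scale scaleR_zero_left span_zero)
qed

text \<open>Adjoining the apex and passing from affine to linear dimension each cost at most one
  dimension.\<close>

lemma negligible_cone_over_Int:
  assumes "convex S" "S \<noteq> {}" "S \<subseteq> H" "convex T" "T \<noteq> {}" "T \<subseteq> H"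
    and "aff_dim (S \<inter> T) + 2 < int DIM('v)"
  shows "negligible (cone_over w S \<inter> cone_over w T)"
proof (rule negligible_lowdim)
  have "int (dim (cone_over w S \<inter> cone_over w T)) \<le> int (dim (insert w (S \<inter> T)))"
    using cone_over_Int_subset_span[OF assms(1-6)] by (metis dim_span dim_subset of_nat_mono)
  also have "\<dots> \<le> int (dim (S \<inter> T)) + 1" by (simp add: dim_insert)
  also have "int (dim (S \<inter> T)) \<le> aff_dim (insert 0 (S \<inter> T))"
    by (simp add: aff_dim_zero hull_inc dim_insert span_zero)
  also have "\<dots> \<le> aff_dim (S \<inter> T) + 1" by (simp add: aff_dim_insert)
  finally show "dim (cone_over w S \<inter> cone_over w T) < DIM('v)"
    using assms(7) by linarith
qed

lemma measure_cone_over_Union: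
  assumes "finite F" "F \<noteq> {}" "convex (\<Union>F)"
    and F: "\<And>T. T \<in> F \<Longrightarrow> compact T \<and> convex T \<and> T \<noteq> {} \<and> T \<subseteq> H"
    and "\<And>S T. S \<in> F \<Longrightarrow> T \<in> F \<Longrightarrow> S \<noteq> T \<Longrightarrow> aff_dim (S \<inter> T) + 2 < int DIM('v)"
  shows "measure lebesgue (cone_over w (\<Union>F)) = (\<Sum>T\<in>F. measure lebesgue (cone_over w T))"
proof -
  have "cone_over w (\<Union>F) = (\<Union>T\<in>F. cone_over w T)"
    using F assms by (intro cone_over_Union) auto
  moreover have "cone_over w T \<in> lmeasurable" if "T \<in> F" for T
    unfolding cone_over_def using F[OF that]
    by (intro lmeasurable_compact compact_convex_hull compact_insert) auto
  moreover have "pairwise (\<lambda>S T. negligible (cone_over w S \<inter> cone_over w T)) F"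
    using assms F by (intro pairwiseI negligible_cone_over_Int) auto
  ultimately show ?thesis
    using measure_negligible_finite_Union_image[OF \<open>finite F\<close>] by metis
qed

text \<open>The hyperplane \<open>P \<bullet> x = 1\<close> misses the origin, so affine
  independence of \<open>C\<close> becomes linear independence. The functional \<open>P - Q\<close>
  vanishes on \<open>C\<close> but not at \<open>w\<close>.\<close>

lemma independent_insert_apex:
  assumes "C \<subseteq> H" and "\<not> affine_dependent C"
  shows "independent (insert w C)"
proof -
  have "affine hull C \<subseteq> {x. P \<bullet> x = 1}"
    using assms H by (intro hull_minimal affine_hyperplane) auto
  then have "\<not> affine_dependent (insert 0 C)"
    using assms by (intro affine_independent_insert) auto
  moreover have "0 \<notin> C" using assms H by force
  ultimately have "independent C"
    by (simp add: affine_dependent_iff_dependent)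
  moreover have "span C \<subseteq> {x. (P - Q) \<bullet> x = 0}"
    using assms H by (intro span_minimal subspace_hyperplane) (auto simp: inner_diff_left)
  then have "w \<notin> span C" using w by (auto simp: inner_diff_left)
  ultimately show ?thesis by (simp add: independent_insertI)
qed

end

lemma measure_cone_over_simplex:
  fixes C :: "(real^'k::{finite,wellorder}) set"
  assumes "finite C" "card C + 1 = CARD('k)" "w \<notin> C" "w \<noteq> 0" "0 \<notin> C"
  obtains r where "bij_betw r (UNIV :: 'k set) (insert w C)"
    and "measure lebesgue (cone_over w (convex hull C)) = \<bar>det (\<chi> k. r k)\<bar> / fact CARD('k)"
proof -
  let ?X = "insert 0 (insert w C)"
  have "card (UNIV :: 'k set) = card (insert w C)" using assms by simp
  then obtain r where r: "bij_betw r (UNIV :: 'k set) (insert w C)"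
    using assms(1) by (meson finite_code finite_insert finite_same_card_bij)
  have "?X - {0} = insert w C" using assms by auto
  then have "measure lborel (convex hull ?X)
      = \<bar>det (\<chi> i j. r j $ i - (0 :: real^'k::_) $ i)\<bar> / fact CARD('k)"
    using assms r by (intro content_simplex) auto
  \<comment> \<open>The simplex formula puts the vertices, measured from the origin, into columns;
    here they are rows.\<close>
  also have "(\<chi> i j. r j $ i - (0 :: real^'k::_) $ i) = transpose (\<chi> k. r k)"
    by (simp add: transpose_def vec_eq_iff)
  also have "measure lborel (convex hull ?X) = measure lebesgue (convex hull ?X)"
    using assms(1) by (intro measure_completion[symmetric])
      (simp add: borel_closed compact_imp_closed compact_convex_hull finite_imp_compact)
  also have "convex hull ?X = cone_over w (convex hull C)"
    unfolding cone_over_def by (metis hull_insert insert_commute)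
  finally show ?thesis using that r by (simp add: det_transpose)
qed

text \<open>Supplies the functionals \<open>P\<close> and \<open>Q\<close>: a generator has exactly
  one unit coordinate on each side.\<close>

lemma edge_vectors_hull_inner:
  assumes "x \<in> convex hull (edge_vectors L)"
  shows "(\<chi> i. if i \<in> L then 1 else 0) \<bullet> x = 1 \<and> (\<chi> i. if i \<in> L then 0 else 1) \<bullet> x = 1"
proof -
  let ?p = "(\<chi> i. if i \<in> L then 1 else 0) :: real^'a"
  let ?q = "(\<chi> i. if i \<in> L then 0 else 1) :: real^'a"
  have "convex hull (edge_vectors L) \<subseteq> {x. ?p \<bullet> x = 1} \<inter> {x. ?q \<bullet> x = 1}"
    by (intro hull_minimal convex_Int convex_hyperplane)
      (auto simp: edge_vectors_def inner_add_right inner_axis)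
  then show ?thesis using assms by auto
qed

text \<open>The measure is a determinant over a factorial. Unimodularity at the generators bounds it
  by multilinearity, and for edge vectors independence excludes the value 0.\<close>

lemma measure_cone_over_edge_simplex:
  fixes C :: "(real^'k::{finite,wellorder}) set"
  assumes i0: "i0 \<in> L" and C: "card C + 1 = CARD('k)" "\<not> affine_dependent C"
  shows "C \<subseteq> convex hull (edge_vectors L) \<Longrightarrow>
      measure lebesgue (cone_over (axis i0 1) (convex hull C)) \<le> 1 / fact CARD('k)"
    and "C \<subseteq> edge_vectors L \<Longrightarrow>
      measure lebesgue (cone_over (axis i0 1) (convex hull C)) = 1 / fact CARD('k)"
proof -
  let ?w = "axis i0 1 :: real^'k::_"
  let ?p = "(\<chi> i. if i \<in> L then 1 else 0) :: real^'k::_"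
  let ?q = "(\<chi> i. if i \<in> L then 0 else 1) :: real^'k::_"
  have pqw: "?p \<bullet> ?w = 1" "?q \<bullet> ?w = 0" using i0 by (simp_all add: inner_axis)
  have unimodular: "\<bar>det (\<chi> k. s k)\<bar> \<le> 1"
    if "\<And>k. s k \<in> insert ?w (edge_vectors L)" for s :: "'k \<Rightarrow> real^'k::_"
    using det_edge_rows_unimodular[of s, OF that i0] by fastforce
  have *: "measure lebesgue (cone_over ?w (convex hull C)) \<le> 1 / fact CARD('k) \<and>
    (C \<subseteq> edge_vectors L \<longrightarrow>
      measure lebesgue (cone_over ?w (convex hull C)) = 1 / fact CARD('k))"
    if sub: "C \<subseteq> convex hull (edge_vectors L)"
  proof -
    note H = edge_vectors_hull_inner[of _ L]
    have indep: "independent (insert ?w C)"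
      by (rule independent_insert_apex[OF pqw H sub C(2)])
    have "?w \<notin> C" using sub H pqw by fastforce
    moreover have "0 \<notin> C" "?w \<noteq> 0" using indep dependent_zero by auto
    ultimately obtain r where r: "bij_betw r (UNIV :: 'k set) (insert ?w C)"
      and m: "measure lebesgue (cone_over ?w (convex hull C)) = \<bar>det (\<chi> k. r k)\<bar> / fact CARD('k)"
      using measure_cone_over_simplex[OF aff_independent_finite[OF C(2)] C(1)] by metis
    have rng: "range r = insert ?w C" using r by (simp add: bij_betw_def)
    have "insert ?w C \<subseteq> convex hull (insert ?w (edge_vectors L))"
      using sub hull_mono[OF subset_insertI, of convex] by (auto simp: hull_inc)
    then have "r k \<in> convex hull (insert ?w (edge_vectors L))" for k
      using rng rangeI[of r k] by auto
    then have "\<bar>det (\<chi> k. r k)\<bar> \<le> 1"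
      using abs_det_convex_hull_le[of "insert ?w (edge_vectors L)" 1 r] unimodular by blast
    moreover have "\<bar>det (\<chi> k. r k)\<bar> = 1" if "C \<subseteq> edge_vectors L"
    proof (rule det_edge_rows_unimodular[OF _ i0])
      show "r k \<in> insert ?w (edge_vectors L)" for k using rng that by blast
      \<comment> \<open>The rows are independent and as many as the dimension, so the matrix has
        full rank.\<close>
      have "rank (\<chi> k. r k) = dim (insert ?w C)"
        unfolding row_rank_def rng[symmetric] by (simp add: rows_def row_def full_SetCompr_eq)
      also have "\<dots> = CARD('k)"
        using dim_eq_card_independent[OF indep] r by (simp add: bij_betw_same_card)
      finally show "det (\<chi> k. r k) \<noteq> 0" by (simp add: det_eq_0_rank)
    qed
    ultimately show ?thesis by (auto simp: m divide_right_mono)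
  qed
  show "C \<subseteq> convex hull (edge_vectors L) \<Longrightarrow>
      measure lebesgue (cone_over ?w (convex hull C)) \<le> 1 / fact CARD('k)"
    using * by blast
  show "C \<subseteq> edge_vectors L \<Longrightarrow>
      measure lebesgue (cone_over ?w (convex hull C)) = 1 / fact CARD('k)"
    using * hull_subset[of "edge_vectors L" convex] by auto
qed

subsection \<open>Comparing triangulations by volume\<close>

text \<open>Concatenates the two coordinate vectors, moving to a type of the form
  \<open>real^'k\<close> where determinants are available.\<close>

definition embed :: "(real^'m::finite) \<times> (real^'n::finite) \<Rightarrow> real^('m, 'n) index" where
  "embed z = (\<chi> k. case Rep_index k of Inl i \<Rightarrow> fst z $ i | Inr j \<Rightarrow> snd z $ j)"

definition left_indices :: "('m, 'n) index set" where
  "left_indices = {k. isl (Rep_index k)}"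

lemma linear_embed: "linear embed"
  by (rule linearI) (auto simp: embed_def vec_eq_iff split: sum.split)

lemma inj_embed: "inj embed"
proof (rule injI)
  fix z z' :: "(real^'m) \<times> (real^'n)"
  assume eq: "embed z = embed z'"
  have "fst z $ i = fst z' $ i" for i
    using arg_cong[OF eq, of "\<lambda>v. v $ Abs_index (Inl i)"] by (simp add: embed_def Abs_index_inverse)
  moreover have "snd z $ j = snd z' $ j" for j
    using arg_cong[OF eq, of "\<lambda>v. v $ Abs_index (Inr j)"] by (simp add: embed_def Abs_index_inverse)
  ultimately show "z = z'" by (simp add: prod_eq_iff vec_eq_iff)
qed

text \<open>Vertices of the product become edge vectors, one endpoint per factor.\<close>

lemma embed_axis:
  "embed (axis i 1, axis j 1) = axis (Abs_index (Inl i)) 1 + axis (Abs_index (Inr j)) 1"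
proof -
  have "embed (axis i 1, axis j 1) $ Abs_index s =
      (axis (Abs_index (Inl i)) 1 + axis (Abs_index (Inr j)) 1) $ Abs_index s" for s
    by (cases s) (auto simp: embed_def Abs_index_inverse Abs_index_inject axis_def)
  then show ?thesis unfolding vec_eq_iff by (metis Rep_index_inverse)
qed

lemma affine_independent_linear_image:
  fixes f :: "'a::euclidean_space \<Rightarrow> 'b::euclidean_space"
  assumes "linear f" "inj f" "\<not> affine_dependent C"
  shows "\<not> affine_dependent (f ` C)"
  using assms card_image[OF inj_on_subset[OF assms(2)], of C]
  by (simp add: affine_independent_iff_card)

text \<open>Distinct cells meet in a proper face of at least one of them, and proper faces have
  smaller dimension.\<close>

lemma aff_dim_triangulation_Int_less:
  assumes "triangulates \<T> S" "A \<in> \<T>" "B \<in> \<T>" "A \<noteq> B"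
  shows "aff_dim (A \<inter> B) < aff_dim S"
proof -
  have sim: "aff_dim S simplex A" "aff_dim S simplex B"
    and face: "A \<inter> B face_of A" "B \<inter> A face_of B"
    using assms by (auto simp: triangulates_def triangulation_def)
  have "convex A" "convex B" using sim by (auto dest: simplex_imp_polytope polytope_imp_convex)
  then have "A \<inter> B \<noteq> A \<Longrightarrow> ?thesis" "B \<inter> A \<noteq> B \<Longrightarrow> ?thesis"
    using face_of_aff_dim_lt face aff_dim_simplex[OF sim(1)] aff_dim_simplex[OF sim(2)]
    by (metis Int_commute)+
  then show ?thesis using assms(4) by blast
qed

section \<open>Volumes of cells and the count\<close>

context simplex_product
begin

definition volume :: "((real^'m) \<times> (real^'n)) set \<Rightarrow> real" where
  "volume T = measure lebesgue (cone_over (axis (Abs_index (Inl (g 0))) 1) (embed ` T))"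

lemma embed_product:
  "embed ` product \<subseteq> convex hull (edge_vectors left_indices)"
  "embed ` vertices product \<subseteq> edge_vectors left_indices"
proof -
  show *: "embed ` vertices product \<subseteq> edge_vectors left_indices"
    by (auto simp: vertices_product vertex_def embed_axis edge_vectors_def left_indices_def
        Abs_index_inverse) (metis Abs_index_inverse UNIV_I sum.disc)
  then have "embed ` vertex ` grid \<subseteq> edge_vectors left_indices"
    by (simp only: vertices_product)
  then show "embed ` product \<subseteq> convex hull (edge_vectors left_indices)"
    unfolding product_eq_hull convex_hull_linear_image[OF linear_embed]
    by (rule hull_mono)
qed

lemma volume_simplex:
  assumes T: "int (a + b) simplex T" "T \<subseteq> product"
  shows "volume T \<le> 1 / fact (a + b + 2)"
    and "vertices T \<subseteq> vertices product \<Longrightarrow> volume T = 1 / fact (a + b + 2)"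
proof -
  let ?w = "Abs_index (Inl (g 0)) :: ('m, 'n) index"
  obtain C where C: "\<not> affine_dependent C" "card C = a + b + 1" "T = convex hull C"
    using T(1) unfolding simplex_def by auto
  have w: "?w \<in> left_indices" by (simp add: left_indices_def Abs_index_inverse)
  have dep: "\<not> affine_dependent (embed ` C)"
    by (rule affine_independent_linear_image[OF linear_embed inj_embed C(1)])
  have card: "card (embed ` C) + 1 = CARD(('m, 'n) index)"
    using C(2) card_image[OF inj_on_subset[OF inj_embed], of C] by (simp add: card_index card_m card_n)
  have vol: "volume T = measure lebesgue (cone_over (axis ?w 1) (convex hull (embed ` C)))"
    unfolding volume_def C(3) convex_hull_linear_image[OF linear_embed] ..
  have N: "CARD(('m, 'n) index) = a + b + 2" by (simp add: card_index card_m card_n)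
  have "C \<subseteq> product" using T(2) C(3) hull_subset by fastforce
  then have "embed ` C \<subseteq> convex hull (edge_vectors left_indices)"
    using embed_product(1) by blast
  then show "volume T \<le> 1 / fact (a + b + 2)"
    using measure_cone_over_edge_simplex(1)[OF w card dep] unfolding vol N by blast
  \<comment> \<open>The generators of a cell are its extreme points, so the vertex condition applies
    to \<open>C\<close>.\<close>
  have "vertices T = C"
    unfolding vertices_def C(3) using extreme_point_of_convex_hull_affine_independent[OF C(1)] by simp
  then have "embed ` C \<subseteq> edge_vectors left_indices" if "vertices T \<subseteq> vertices product"
    using embed_product(2) that by blast
  then show "vertices T \<subseteq> vertices product \<Longrightarrow> volume T = 1 / fact (a + b + 2)"
    using measure_cone_over_edge_simplex(2)[OF w card dep] unfolding vol N by blast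
qed

text \<open>The cones over the cells fill the cone over the product and overlap in null
  sets.\<close>

lemma volume_triangulation:
  assumes "triangulates \<T> product"
  shows "volume product = (\<Sum>T\<in>\<T>. volume T)"
proof -
  let ?w = "axis (Abs_index (Inl (g 0))) 1 :: real^('m, 'n) index"
  let ?L = "left_indices :: ('m, 'n) index set"
  let ?p = "(\<chi> i. if i \<in> ?L then 1 else 0) :: real^('m, 'n) index"
  let ?q = "(\<chi> i. if i \<in> ?L then 0 else 1) :: real^('m, 'n) index"
  let ?F = "(`) embed ` \<T>"
  have fin: "finite \<T>" and un: "\<Union>\<T> = product"
    and sim: "\<And>T. T \<in> \<T> \<Longrightarrow> int (a + b) simplex T"
    using assms unfolding triangulates_def triangulation_def aff_dim_product by auto
  have conv: "convex product"
    unfolding product_eq_hull by (rule convex_convex_hull)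
  have w: "?p \<bullet> ?w = 1" "?q \<bullet> ?w = 0"
    by (simp_all add: inner_axis left_indices_def Abs_index_inverse)
  have unF: "\<Union>?F = embed ` product" by (simp add: image_Union flip: un)
  have "product \<noteq> {}"
    using aff_dim_product by auto
  then have "\<T> \<noteq> {}" using un by auto
  have "measure lebesgue (cone_over ?w (\<Union>?F)) = (\<Sum>T\<in>?F. measure lebesgue (cone_over ?w T))"
  proof (rule measure_cone_over_Union[OF w edge_vectors_hull_inner[of _ ?L]])
    show "finite ?F" "?F \<noteq> {}" using fin \<open>\<T> \<noteq> {}\<close> by auto
    show "convex (\<Union>?F)"
      unfolding unF by (rule convex_linear_image[OF linear_embed conv])
    show "compact T \<and> convex T \<and> T \<noteq> {} \<and> T \<subseteq> convex hull edge_vectors ?L" if "T \<in> ?F" for T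
    proof -
      obtain S where S: "S \<in> \<T>" "T = embed ` S" using \<open>T \<in> ?F\<close> by blast
      have "compact S" "convex S" "S \<noteq> {}"
        using simplex_imp_polytope[OF sim[OF S(1)]] aff_dim_simplex[OF sim[OF S(1)]]
        by (auto simp: polytope_imp_compact polytope_imp_convex)
      moreover have "S \<subseteq> product" using S(1) un by blast
      ultimately show ?thesis
        unfolding S(2) using embed_product(1)
          compact_continuous_image[OF linear_continuous_on, of embed S]
          convex_linear_image[OF linear_embed, of S] linear_embed
        by (simp add: linear_linear) blast
    qed
    fix S T assume "S \<in> ?F" "T \<in> ?F" "S \<noteq> T"
    then obtain A B where AB: "A \<in> \<T>" "B \<in> \<T>" "A \<noteq> B" "S = embed ` A" "T = embed ` B" by blast
    have "aff_dim (S \<inter> T) = aff_dim (A \<inter> B)"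
      unfolding AB(4,5) image_Int[OF inj_embed, symmetric]
      by (rule aff_dim_injective_linear_image[OF linear_embed inj_embed])
    \<comment> \<open>The ambient dimension is \<open>a + b + 2\<close>, so this is the bound that
      makes overlaps of cones negligible.\<close>
    also have "\<dots> < int (a + b)"
      using aff_dim_triangulation_Int_less[OF assms AB(1-3)] by (simp add: aff_dim_product)
    finally show "aff_dim (S \<inter> T) + 2 < int DIM(real^('m, 'n) index)"
      by (simp add: card_index card_m card_n)
  qed
  also have "\<dots> = (\<Sum>T\<in>\<T>. volume T)"
    unfolding volume_def using inj_image_eq_iff[OF inj_embed]
    by (subst sum.reindex) (auto simp: inj_on_def)
  finally show ?thesis unfolding volume_def unF .
qed

text \<open>Both families have the same total volume; each cell of \<open>\<V>\<close> attains the
  maximal cell volume, which bounds every cell of \<open>\<T>\<close>.\<close>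

lemma card_vertex_triangulation_le:
  assumes "triangulates \<T> product" "vertex_triangulates \<V> product"
  shows "card \<V> \<le> card \<T>"
proof -
  have V: "triangulates \<V> product" using assms(2) by (simp add: vertex_triangulates_def)
  have cell: "int (a + b) simplex T" "T \<subseteq> product" if "triangulates \<U> product" "T \<in> \<U>" for \<U> T
    using that unfolding triangulates_def aff_dim_product by auto
  have "real (card \<V>) * (1 / fact (a + b + 2)) = (\<Sum>T\<in>\<V>. volume T)"
    using volume_simplex(2)[OF cell[OF V]] assms(2) by (simp add: vertex_triangulates_def)
  also have "\<dots> = (\<Sum>T\<in>\<T>. volume T)"
    using volume_triangulation[OF V] volume_triangulation[OF assms(1)] by simp
  also have "\<dots> \<le> real (card \<T>) * (1 / fact (a + b + 2))"
    using volume_simplex(1)[OF cell[OF assms(1)]] by (intro sum_bounded_above) blast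
  finally show ?thesis by (simp add: divide_le_cancel)
qed

end

theorem theorem4:
  fixes a b :: nat and P :: "((real^'m) \<times> (real^'n)) set"
  assumes "a \<ge> 1" and "b \<ge> 1"
    and "CARD('m) = a + 1" and "CARD('n) = b + 1"
    and "P = std_simplex \<times> std_simplex"
  shows "(\<forall>\<T> \<V>. triangulates \<T> P \<longrightarrow> vertex_triangulates \<V> P \<longrightarrow> card \<V> \<le> card \<T>)
    \<and> (\<exists>\<V>. vertex_triangulates \<V> P \<and> card \<V> = (a + b) choose a)
    \<and> (\<forall>\<T>. minimally_triangulates \<T> P \<longrightarrow> card \<T> = (a + b) choose a)"
proof -
  have "card {..a} = CARD('m)" "card {..b} = CARD('n)" using assms by simp_all
  then obtain g :: "nat \<Rightarrow> 'm" and h :: "nat \<Rightarrow> 'n"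
    where "bij_betw g {..a} UNIV" "bij_betw h {..b} UNIV"
    using finite_same_card_bij by (metis finite finite_atMost)
  then interpret simplex_product g h a b by unfold_locales
  have le: "triangulates \<T> P \<Longrightarrow> vertex_triangulates \<V> P \<Longrightarrow> card \<V> \<le> card \<T>" for \<T> \<V>
    unfolding assms(5) by (rule card_vertex_triangulation_le)
  obtain \<V> where \<V>: "vertex_triangulates \<V> P" "card \<V> = (a + b) choose a"
    using staircase_triangulation assms(5) by blast
  \<comment> \<open>Minimality against the staircase triangulation gives one inequality, the volume
    comparison the other.\<close>
  have "card \<T> = (a + b) choose a" if "minimally_triangulates \<T> P" for \<T>
    using that le[of \<T> \<V>] \<V>
    by (auto simp: minimally_triangulates_def vertex_triangulates_def intro: antisym)
  then show ?thesis using le \<V> by blast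
qed

end
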